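(* Let $X$ be a complex analytic manifold which is $c_X^i$-hyperbolic (i.e. the integrated Carathéodory pseudodistance $c_X^i$ is a distance on $X$), and let $U\subset X$ be a domain which is relatively compact in $X$. Then there exists a constant $k<1$ such that, for all $a\in U$ and all $v\in T_aX$, $$E_X(a,v)\leq k\,E_U(a,v).$$ More precisely, one can take $k=\tanh M$, where $M=\sup_{x,y\in U}c_X(x,y)$ is the diameter of $U$ for the Carathéodory pseudodistance $c_X$ of $X$. Consequently, for all $a,b\in U$, $$c_X^i(a,b)\leq k\,c_U^i(a,b).$$
   Context: A domain is a nonempty connected open set. $\Delta\subset\mathbb{C}$ is the open unit disc, and $H(Y,\Delta)$ is the set of holomorphic maps $Y\to\Delta$. The Poincaré distance on $\Delta$ is $\omega(z,w)=\tanh^{-1}\left|\frac{z-w}{1-\overline{w}z}\right|$. For a complex manifold $Y$: the Carathéodory infinitesimal pseudometric is $E_Y(x,v)=\sup_{\varphi\in H(Y,\Delta)}|\varphi'(x).v|$ for $x\in Y$, $v\in T_xY$; the Carathéodory pseudodistance is $c_Y(a,b)=\sup_{\varphi\in H(Y,\Delta)}\omega(\varphi(a),\varphi(b))$; the integrated Carathéodory pseudodistance $c_Y^i(a,b)$ is the infimum, over all piecewise $C^1$ paths $\gamma:[0,1]\to Y$ with $\gamma(0)=a$, $\gamma(1)=b$, of the length $\int_0^1E_Y(\gamma(t),\gamma'(t))\,dt$. A distance is a finite-valued metric (a pseudodistance that separates points). For $a\in U$, $T_aU$ is identified with $T_aX$ since $U$ is open in $X$. *)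

theory Defs
  imports "HOL-Analysis.Analysis"
begin

section \<open>Complex Banach spaces as model spaces\<close>

text \<open>
  The model space of a manifold is a type of class \<open>complex_banach\<close>. The instance \<open>complex ^ 'n\<close> below
  gives manifolds of dimension \<open>CARD('n)\<close>, and the instance \<open>unit\<close> gives dimension 0.
\<close>

class complex_normed_vector = real_normed_vector +
  fixes scaleC :: "complex \<Rightarrow> 'a \<Rightarrow> 'a"
  assumes scaleC_add_right: "scaleC c (x + y) = scaleC c x + scaleC c y"
    and scaleC_add_left: "scaleC (c + d) x = scaleC c x + scaleC d x"
    and scaleC_scaleC: "scaleC c (scaleC d x) = scaleC (c * d) x"
    and scaleC_of_real: "scaleC (complex_of_real r) x = scaleR r x"
    and norm_scaleC: "norm (scaleC c x) = cmod c * norm x"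

class complex_banach = complex_normed_vector + banach

instantiation complex :: complex_banach
begin
definition scaleC_complex :: "complex \<Rightarrow> complex \<Rightarrow> complex" where
  "scaleC_complex c x = c * x"
instance
  by standard (simp_all add: scaleC_complex_def algebra_simps norm_mult scaleR_conv_of_real)
end

instantiation vec :: (complex_normed_vector, finite) complex_normed_vector
begin
definition scaleC_vec :: "complex \<Rightarrow> 'a ^ 'b \<Rightarrow> 'a ^ 'b" where
  "scaleC_vec c x = (\<chi> i. scaleC c (x $ i))"
instance
proof
  fix c :: complex and x :: "'a ^ 'b"
  show "norm (scaleC c x) = cmod c * norm x"
    by (simp add: scaleC_vec_def norm_vec_def norm_scaleC L2_set_right_distrib)
qed (simp_all add: scaleC_vec_def vec_eq_iff scaleC_add_right scaleC_add_left scaleC_scaleC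
      scaleC_of_real)
end

instance vec :: (complex_banach, finite) complex_banach ..

instantiation unit :: real_normed_vector
begin
definition zero_unit :: unit where "zero_unit = ()"
definition plus_unit :: "unit \<Rightarrow> unit \<Rightarrow> unit" where "plus_unit x y = ()"
definition scaleR_unit :: "real \<Rightarrow> unit \<Rightarrow> unit" where "scaleR_unit r x = ()"
definition norm_unit :: "unit \<Rightarrow> real" where "norm_unit x = 0"
definition sgn_unit :: "unit \<Rightarrow> unit" where "sgn_unit x = ()"
definition dist_unit :: "unit \<Rightarrow> unit \<Rightarrow> real" where "dist_unit x y = 0"
definition uniformity_unit :: "(unit \<times> unit) filter" where
  "uniformity_unit = (INF e\<in>{0<..}. principal {(x, y). dist x y < e})"
definition open_unit :: "unit set \<Rightarrow> bool" where
  "open_unit U \<longleftrightarrow> (\<forall>x\<in>U. eventually (\<lambda>(x', y). x' = x \<longrightarrow> y \<in> U) uniformity)"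
instance
  by standard (simp_all add: norm_unit_def dist_unit_def uniformity_unit_def open_unit_def)
end

instantiation unit :: complex_banach
begin
definition scaleC_unit :: "complex \<Rightarrow> unit \<Rightarrow> unit" where "scaleC_unit c x = ()"
instance
proof
  fix X :: "nat \<Rightarrow> unit"
  have "X = (\<lambda>_. ())"
    by auto
  then show "convergent X"
    by (metis convergent_const)
qed (simp_all add: norm_unit_def)
end

definition cholomorphic_on ::
  "('e::complex_normed_vector \<Rightarrow> 'f::complex_normed_vector) \<Rightarrow> 'e set \<Rightarrow> bool"
  where "cholomorphic_on f S \<longleftrightarrow>
    (\<forall>z\<in>S. \<exists>D. (f has_derivative D) (at z) \<and> (\<forall>c v. D (scaleC c v) = scaleC c (D v)))"

lemma cholomorphic_on_complex_iff:
  fixes f :: "complex \<Rightarrow> complex"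
  assumes "open S"
  shows "cholomorphic_on f S \<longleftrightarrow> f holomorphic_on S"
proof
  assume f: "cholomorphic_on f S"
  show "f holomorphic_on S"
    unfolding holomorphic_on_def
  proof
    fix z assume "z \<in> S"
    with f obtain D where D: "(f has_derivative D) (at z)" "\<And>c v. D (c * v) = c * D v"
      unfolding cholomorphic_on_def scaleC_complex_def by blast
    have "D = (*) (D 1)"
    proof
      fix w show "D w = D 1 * w"
        using D(2)[of w 1] by (metis mult.commute mult.right_neutral)
    qed
    with D(1) have "(f has_field_derivative D 1) (at z)"
      by (simp add: has_field_derivative_def)
    then show "f field_differentiable at z within S"
      using field_differentiable_at_within field_differentiable_def by blast
  qed
next
  assume f: "f holomorphic_on S"
  show "cholomorphic_on f S"
    unfolding cholomorphic_on_def
  proof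
    fix z assume "z \<in> S"
    with f assms obtain d where "(f has_field_derivative d) (at z)"
      by (meson field_differentiable_def holomorphic_on_imp_differentiable_at)
    then show "\<exists>D. (f has_derivative D) (at z) \<and> (\<forall>c v. D (scaleC c v) = scaleC c (D v))"
      by (auto simp: has_field_derivative_def scaleC_complex_def mult.left_commute)
  qed
qed


section \<open>Complex manifolds\<close>

text \<open>
  A chart is a pair of an open domain and a coordinate map; outside its domain the coordinate map
  is irrelevant. The atlas need not be maximal.
\<close>

type_synonym ('a, 'e) chart = "'a set \<times> ('a \<Rightarrow> 'e)"

record ('a, 'e) cmanifold =
  mtop :: "'a topology"
  atlas :: "('a, 'e) chart set"

definition coord_inv :: "('a, 'e) chart \<Rightarrow> 'e \<Rightarrow> 'a"
  where "coord_inv c = inv_into (fst c) (snd c)"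

definition complex_manifold :: "('a, 'e::complex_banach) cmanifold \<Rightarrow> bool"
  where "complex_manifold X \<longleftrightarrow>
    Hausdorff_space (mtop X) \<and>
    \<Union>(fst ` atlas X) = topspace (mtop X) \<and>
    (\<forall>c\<in>atlas X. openin (mtop X) (fst c) \<and> open (snd c ` fst c) \<and>
       homeomorphic_map (subtopology (mtop X) (fst c)) (top_of_set (snd c ` fst c)) (snd c)) \<and>
    (\<forall>c\<in>atlas X. \<forall>d\<in>atlas X. cholomorphic_on (snd d \<circ> coord_inv c) (snd c ` (fst c \<inter> fst d)))"

definition charts_at :: "('a, 'e) cmanifold \<Rightarrow> 'a \<Rightarrow> ('a, 'e) chart set"
  where "charts_at X x = {c \<in> atlas X. x \<in> fst c}"

text \<open>
  A tangent vector at \<open>x\<close> is given by its coordinate vectors in all charts around \<open>x\<close>, which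
  transform into each other by the derivatives of the coordinate changes.
\<close>

definition tangent_space ::
  "('a, 'e::complex_banach) cmanifold \<Rightarrow> 'a \<Rightarrow> (('a, 'e) chart \<Rightarrow> 'e) set"
  where "tangent_space X x = {v \<in> extensional (charts_at X x).
    \<forall>c\<in>charts_at X x. \<forall>d\<in>charts_at X x.
      v d = frechet_derivative (snd d \<circ> coord_inv c) (at (snd c x)) (v c)}"

text \<open>
  \<open>holo_disc X Y\<close> is \<open>H(Y, \<Delta>)\<close> for an open subset \<open>Y\<close> of \<open>X\<close>; \<open>X\<close> itself is the case
  \<open>Y = topspace (mtop X)\<close>. Since \<open>T\<^sub>xY\<close> is \<open>T\<^sub>xX\<close>, all invariants of \<open>Y\<close> are defined on the tangent
  vectors of \<open>X\<close>. Values of maps outside \<open>Y\<close> are irrelevant.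
\<close>

definition holo_disc :: "('a, 'e::complex_banach) cmanifold \<Rightarrow> 'a set \<Rightarrow> ('a \<Rightarrow> complex) set"
  where "holo_disc X Y = {f. f ` Y \<subseteq> ball 0 1 \<and>
    (\<forall>c\<in>atlas X. cholomorphic_on (f \<circ> coord_inv c) (snd c ` (fst c \<inter> Y)))}"

text \<open>
  The differential \<open>f'(x).v\<close>, computed in some chart around \<open>x\<close>; \<open>differential_eq\<close> below shows that
  the choice does not matter.
\<close>

definition differential ::
  "('a, 'e::complex_banach) cmanifold \<Rightarrow> ('a \<Rightarrow> complex) \<Rightarrow> 'a \<Rightarrow> (('a, 'e) chart \<Rightarrow> 'e) \<Rightarrow> complex"
  where "differential X f x v =
    (let c = (SOME c. c \<in> charts_at X x)
     in frechet_derivative (f \<circ> coord_inv c) (at (snd c x)) (v c))"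

lemma differential_eq:
  assumes X: "complex_manifold X" and Y: "openin (mtop X) Y" "x \<in> Y"
    and f: "f \<in> holo_disc X Y" and v: "v \<in> tangent_space X x" and d: "d \<in> charts_at X x"
  shows "differential X f x v = frechet_derivative (f \<circ> coord_inv d) (at (snd d x)) (v d)"
proof -
  define c where "c = (SOME c. c \<in> charts_at X x)"
  have c: "c \<in> charts_at X x"
    unfolding c_def using d by (rule someI)
  have cA: "c \<in> atlas X" "x \<in> fst c" and dA: "d \<in> atlas X" "x \<in> fst d"
    using c d by (auto simp: charts_at_def)
  let ?t = "snd d \<circ> coord_inv c"
  have inj: "inj_on (snd e) (fst e)" if "e \<in> atlas X" for e
  proof -
    have "homeomorphic_map (subtopology (mtop X) (fst e)) (top_of_set (snd e ` fst e)) (snd e)"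
      "openin (mtop X) (fst e)"
      using X that by (auto simp: complex_manifold_def)
    then show ?thesis
      using homeomorphic_imp_injective_map openin_subset topspace_subtopology_subset by fastforce
  qed
  have inv: "coord_inv e (snd e y) = y" if "e \<in> atlas X" "y \<in> fst e" for e y
    using inj[OF that(1)] that(2) by (simp add: coord_inv_def)
  have "\<exists>D. (?t has_derivative D) (at (snd c x))"
  proof -
    have "cholomorphic_on ?t (snd c ` (fst c \<inter> fst d))"
      using X cA dA by (auto simp: complex_manifold_def)
    moreover have "snd c x \<in> snd c ` (fst c \<inter> fst d)"
      using cA dA by blast
    ultimately show ?thesis
      unfolding cholomorphic_on_def by blast
  qed
  then have t: "(?t has_derivative frechet_derivative ?t (at (snd c x))) (at (snd c x))"
    by (auto simp: differentiable_def simp flip: frechet_derivative_works)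
  have "\<exists>D. ((f \<circ> coord_inv d) has_derivative D) (at (snd d x))"
  proof -
    have "cholomorphic_on (f \<circ> coord_inv d) (snd d ` (fst d \<inter> Y))"
      using f dA by (auto simp: holo_disc_def)
    moreover have "snd d x \<in> snd d ` (fst d \<inter> Y)"
      using dA Y by blast
    ultimately show ?thesis
      unfolding cholomorphic_on_def by blast
  qed
  then have g: "((f \<circ> coord_inv d) has_derivative
      frechet_derivative (f \<circ> coord_inv d) (at (snd d x))) (at (?t (snd c x)))"
    using inv[OF cA] by (auto simp: differentiable_def simp flip: frechet_derivative_works)
  have comp: "((f \<circ> coord_inv d) \<circ> ?t has_derivative
      frechet_derivative (f \<circ> coord_inv d) (at (snd d x)) \<circ> frechet_derivative ?t (at (snd c x)))
      (at (snd c x))"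
    using diff_chain_at[OF t g] .
  have hom: "homeomorphic_map (subtopology (mtop X) (fst c)) (top_of_set (snd c ` fst c)) (snd c)"
    and opn: "openin (mtop X) (fst c)" "openin (mtop X) (fst d)" "open (snd c ` fst c)"
    using X cA dA by (auto simp: complex_manifold_def)
  have "openin (subtopology (mtop X) (fst c)) (fst c \<inter> fst d)"
    using opn by (simp add: openin_open_subtopology openin_Int)
  then have "openin (top_of_set (snd c ` fst c)) (snd c ` (fst c \<inter> fst d))"
    using homeomorphic_imp_open_map[OF hom] unfolding open_map_def by blast
  then have op: "open (snd c ` (fst c \<inter> fst d))"
    using openin_open_eq[OF opn(3)] by blast
  have "(f \<circ> coord_inv c has_derivative
      frechet_derivative (f \<circ> coord_inv d) (at (snd d x)) \<circ> frechet_derivative ?t (at (snd c x)))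
      (at (snd c x))"
    by (rule has_derivative_transform_within_open[OF comp op])
      (use cA dA inv[OF cA(1)] inv[OF dA(1)] in \<open>auto simp: o_def\<close>)
  then have "frechet_derivative (f \<circ> coord_inv c) (at (snd c x)) =
      frechet_derivative (f \<circ> coord_inv d) (at (snd d x)) \<circ> frechet_derivative ?t (at (snd c x))"
    by (rule frechet_derivative_at[symmetric])
  moreover have "v d = frechet_derivative ?t (at (snd c x)) (v c)"
    using v c d unfolding tangent_space_def by blast
  ultimately show ?thesis
    by (simp add: differential_def flip: c_def)
qed


section \<open>The Caratheodory pseudometric and pseudodistances\<close>

text \<open>Suprema, infima and lengths are taken in the extended nonnegative reals.\<close>

definition poincare_dist :: "complex \<Rightarrow> complex \<Rightarrow> real"
  where "poincare_dist z w = artanh (cmod ((z - w) / (1 - cnj w * z)))"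

definition cara_metric ::
  "('a, 'e::complex_banach) cmanifold \<Rightarrow> 'a set \<Rightarrow> 'a \<Rightarrow> (('a, 'e) chart \<Rightarrow> 'e) \<Rightarrow> ennreal"
  where "cara_metric X Y x v = (SUP f\<in>holo_disc X Y. ennreal (cmod (differential X f x v)))"

definition cara_dist :: "('a, 'e::complex_banach) cmanifold \<Rightarrow> 'a set \<Rightarrow> 'a \<Rightarrow> 'a \<Rightarrow> ennreal"
  where "cara_dist X Y a b = (SUP f\<in>holo_disc X Y. ennreal (poincare_dist (f a) (f b)))"

definition C1_curve_on :: "('a, 'e::complex_banach) cmanifold \<Rightarrow> real \<Rightarrow> real \<Rightarrow> (real \<Rightarrow> 'a) \<Rightarrow> bool"
  where "C1_curve_on X s t \<gamma> \<longleftrightarrow>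
    (\<forall>c\<in>atlas X. \<exists>D. continuous_on {u \<in> {s..t}. \<gamma> u \<in> fst c} D \<and>
      (\<forall>u\<in>{s..t}. \<gamma> u \<in> fst c \<longrightarrow>
        ((snd c \<circ> \<gamma>) has_vector_derivative D u) (at u within {s..t})))"

definition piecewise_C1_path :: "('a, 'e::complex_banach) cmanifold \<Rightarrow> (real \<Rightarrow> 'a) \<Rightarrow> bool"
  where "piecewise_C1_path X \<gamma> \<longleftrightarrow>
    continuous_map (top_of_set {0..1}) (mtop X) \<gamma> \<and>
    (\<exists>(p :: nat \<Rightarrow> real) m. p 0 = 0 \<and> p m = 1 \<and>
      (\<forall>i<m. p i < p (Suc i) \<and> C1_curve_on X (p i) (p (Suc i)) \<gamma>))"

text \<open>
  The velocity is meaningful away from the finitely many breakpoints of a piecewise continuously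
  differentiable path, which do not contribute to the length.
\<close>

definition velocity ::
  "('a, 'e::complex_banach) cmanifold \<Rightarrow> (real \<Rightarrow> 'a) \<Rightarrow> real \<Rightarrow> ('a, 'e) chart \<Rightarrow> 'e"
  where "velocity X \<gamma> t =
    (\<lambda>c\<in>charts_at X (\<gamma> t). vector_derivative (snd c \<circ> \<gamma>) (at t))"

definition cara_length :: "('a, 'e::complex_banach) cmanifold \<Rightarrow> 'a set \<Rightarrow> (real \<Rightarrow> 'a) \<Rightarrow> ennreal"
  where "cara_length X Y \<gamma> =
    (\<integral>\<^sup>+t\<in>{0..1}. cara_metric X Y (\<gamma> t) (velocity X \<gamma> t) \<partial>lborel)"

definition cara_inner_dist :: "('a, 'e::complex_banach) cmanifold \<Rightarrow> 'a set \<Rightarrow> 'a \<Rightarrow> 'a \<Rightarrow> ennreal"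
  where "cara_inner_dist X Y a b =
    (INF \<gamma>\<in>{\<gamma>. piecewise_C1_path X \<gamma> \<and> \<gamma> ` {0..1} \<subseteq> Y \<and> \<gamma> 0 = a \<and> \<gamma> 1 = b}. cara_length X Y \<gamma>)"

definition cara_inner_hyperbolic :: "('a, 'e::complex_banach) cmanifold \<Rightarrow> bool"
  where "cara_inner_hyperbolic X \<longleftrightarrow>
    (\<forall>a\<in>topspace (mtop X). \<forall>b\<in>topspace (mtop X). cara_inner_dist X (topspace (mtop X)) a b < \<infinity>) \<and>
    Metric_space (topspace (mtop X)) (\<lambda>a b. enn2real (cara_inner_dist X (topspace (mtop X)) a b))"

definition domain_in :: "'a topology \<Rightarrow> 'a set \<Rightarrow> bool"
  where "domain_in T U \<longleftrightarrow> U \<noteq> {} \<and> openin T U \<and> connectedin T U"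

definition relatively_compact_in :: "'a topology \<Rightarrow> 'a set \<Rightarrow> bool"
  where "relatively_compact_in T U \<longleftrightarrow> U \<subseteq> topspace T \<and> compactin T (T closure_of U)"

definition cara_diameter :: "('a, 'e::complex_banach) cmanifold \<Rightarrow> 'a set \<Rightarrow> ennreal"
  where "cara_diameter X U = (SUP x\<in>U. SUP y\<in>U. cara_dist X (topspace (mtop X)) x y)"

end

theory Submission
  imports Defs "HOL-Complex_Analysis.Conformal_Mappings"
begin

text \<open>
  Given \<open>f\<close> in \<open>H(X, \<Delta>)\<close> and \<open>a\<close> in \<open>U\<close>, compose \<open>f\<close> with the Moebius map sending \<open>f a\<close> to \<open>0\<close>. On \<open>U\<close> the
  modulus of the composition is at most \<open>tanh M = k\<close>, so for \<open>r < 1\<close> its product with \<open>r / k\<close> is in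
  \<open>H(U, \<Delta>)\<close>, and the Moebius map does not decrease the derivative at \<open>a\<close>. Letting \<open>r\<close> tend to 1
  gives \<open>E\<^sub>X \<le> k E\<^sub>U\<close>; the inequality of the inner distances follows by integration. That \<open>M\<close> is
  finite comes from compactness: by the Schwarz lemma every point has a neighbourhood on which
  the distance to it is bounded, so the points of \<open>X\<close> at finite distance from a given one form
  an open and closed set.
\<close>

section \<open>The Poincare distance\<close>

text \<open>For fixed \<open>w\<close> in the disc this is the Moebius automorphism taking
  \<open>w\<close> to 0. Its modulus is the pseudohyperbolic distance, that is, \<open>tanh\<close>
  of the Poincare distance.\<close>

definition disc_quot :: "complex \<Rightarrow> complex \<Rightarrow> complex"
  where "disc_quot z w = (z - w) / (1 - cnj w * z)"

lemma poincare_dist_disc_quot: "poincare_dist z w = artanh (cmod (disc_quot z w))"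
  by (simp add: poincare_dist_def disc_quot_def)

lemma disc_quot_self [simp]: "disc_quot z z = 0"
  by (simp add: disc_quot_def)

lemma disc_denom_nonzero:
  assumes "cmod z < 1" "cmod w < 1"
  shows "1 - cnj w * z \<noteq> 0"
proof
  assume "1 - cnj w * z = 0"
  then have "cmod (cnj w * z) = 1"
    by (metis eq_iff_diff_eq_0 norm_one)
  moreover have "cmod w * cmod z < 1 * 1"
    by (rule mult_strict_mono') (use assms in auto)
  ultimately show False
    by (simp add: norm_mult)
qed

text \<open>The mixed terms \<open>2 * Re (cnj w * z)\<close> of the two squares cancel. For points
  of the disc the right-hand side is positive, which is why the Moebius quotient stays in the
  disc.\<close>

lemma norm_disc_quot_identity:
  "(cmod (1 - cnj w * z))\<^sup>2 - (cmod (z - w))\<^sup>2 = (1 - (cmod z)\<^sup>2) * (1 - (cmod w)\<^sup>2)"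
  unfolding cmod_power2 by (simp add: power2_eq_square algebra_simps)

lemma one_minus_norm_disc_quot:
  assumes "cmod z < 1" "cmod w < 1"
  shows "1 - (cmod (disc_quot z w))\<^sup>2 =
    (1 - (cmod z)\<^sup>2) * (1 - (cmod w)\<^sup>2) / (cmod (1 - cnj w * z))\<^sup>2"
  using disc_denom_nonzero[OF assms]
  unfolding norm_disc_quot_identity[symmetric]
  by (simp add: disc_quot_def norm_divide power_divide divide_simps)

lemma norm_disc_quot_less_1:
  assumes "cmod z < 1" "cmod w < 1"
  shows "cmod (disc_quot z w) < 1"
proof -
  have "(cmod z)\<^sup>2 < 1" "(cmod w)\<^sup>2 < 1"
    using assms by (simp_all add: abs_square_less_1)
  then have "0 < 1 - (cmod (disc_quot z w))\<^sup>2"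
    using disc_denom_nonzero[OF assms] by (simp add: one_minus_norm_disc_quot[OF assms])
  then show ?thesis
    by (simp add: abs_square_less_1)
qed

text \<open>Swapping the arguments negates the numerator and conjugates the denominator.\<close>

lemma norm_disc_quot_commute: "cmod (disc_quot z w) = cmod (disc_quot w z)"
proof -
  have "cmod (1 - cnj w * z) = cmod (cnj (1 - cnj w * z))"
    by (rule complex_mod_cnj[symmetric])
  then show ?thesis
    by (simp add: disc_quot_def norm_divide norm_minus_commute mult.commute)
qed

text \<open>
  A weak form of the triangle inequality for the Poincare distance, as
  \<open>1 - (cmod (disc_quot z w))\<^sup>2\<close> is \<open>1 / cosh\<^sup>2\<close> of that distance.
\<close>

lemma one_minus_norm_disc_quot_mult_le:
  assumes z: "cmod z < 1" and u: "cmod u < 1" and w: "cmod w < 1"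
  shows "(1 - (cmod (disc_quot z u))\<^sup>2) * (1 - (cmod (disc_quot u w))\<^sup>2)
    \<le> 4 * (1 - (cmod (disc_quot z w))\<^sup>2)"
proof -
  define A B C where "A = cmod (1 - cnj u * z)" and "B = cmod (1 - cnj w * u)"
    and "C = cmod (1 - cnj w * z)"
  define p q r where "p = 1 - (cmod z)\<^sup>2" and "q = 1 - (cmod u)\<^sup>2" and "r = 1 - (cmod w)\<^sup>2"
  have pos: "A > 0" "B > 0" "C > 0" "p > 0" "q > 0" "r > 0"
    using disc_denom_nonzero[OF z u] disc_denom_nonzero[OF u w] disc_denom_nonzero[OF z w] z u w
    by (auto simp: A_def B_def C_def p_def q_def r_def abs_square_less_1)
  \<comment> \<open>A quotient of modulus less than 1 has its numerator bounded by its denominator;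
    below this trades differences for \<open>A\<close> and \<open>B\<close>.\<close>
  have quot_le: "cmod (x - y) \<le> cmod (1 - cnj y * x)" if "cmod x < 1" "cmod y < 1" for x y
    using norm_disc_quot_less_1[OF that] disc_denom_nonzero[OF that]
    by (simp add: disc_quot_def norm_divide divide_simps split: if_splits)
  have uu: "complex_of_real q = 1 - u * cnj u"
    by (simp add: q_def complex_mult_cnj cmod_power2)
  \<comment> \<open>This identity expresses the denominator of the pair \<open>z\<close>,
    \<open>w\<close> through the numerators and denominators of the pairs \<open>z\<close>,
    \<open>u\<close> and \<open>u\<close>, \<open>w\<close>. It yields
    \<open>q * C \<le> 2 * (A * B)\<close>, whose square accounts for the factor 4.\<close>
  have "complex_of_real q * (1 - cnj w * z) =
      (1 - cnj w * u) * (1 - cnj u * z) - cnj (w - u) * (z - u)"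
    unfolding uu by (simp add: algebra_simps)
  then have "q * C = cmod ((1 - cnj w * u) * (1 - cnj u * z) - cnj (w - u) * (z - u))"
    unfolding C_def using pos by (metis abs_of_pos norm_mult norm_of_real)
  also have "\<dots> \<le> B * A + cmod (cnj (w - u)) * cmod (z - u)"
    unfolding A_def B_def by (rule order.trans[OF norm_triangle_ineq4]) (simp add: norm_mult)
  also have "cmod (cnj (w - u)) * cmod (z - u) \<le> B * A"
    unfolding A_def B_def complex_mod_cnj norm_minus_commute[of w u]
    by (intro mult_mono quot_le z u w) auto
  finally have "q * C \<le> 2 * (A * B)"
    by (simp add: mult.commute)
  then have "(q * C)\<^sup>2 \<le> (2 * (A * B))\<^sup>2"
    using pos by (intro power_mono) auto
  then have "p * r * (q * C)\<^sup>2 \<le> p * r * (2 * (A * B))\<^sup>2"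
    using pos by (intro mult_left_mono) auto
  then have "p * q / A\<^sup>2 * (q * r / B\<^sup>2) \<le> 4 * (p * r / C\<^sup>2)"
    using pos by (simp add: field_simps power2_eq_square)
  then show ?thesis
    by (simp add: one_minus_norm_disc_quot z u w A_def B_def C_def p_def q_def r_def)
qed

lemma tanh_artanh_real:
  fixes x :: real
  assumes "\<bar>x\<bar> < 1"
  shows "tanh (artanh x) = x"
proof -
  have "exp (2 * artanh x) = (1 + x) / (1 - x)"
    using assms by (simp add: artanh_def)
  moreover have "exp (- (2 * artanh x)) = (1 - x) / (1 + x)"
    unfolding exp_minus calculation by simp
  then have "exp (- 2 * artanh x) = (1 - x) / (1 + x)"
    by simp
  then show ?thesis
    using assms unfolding tanh_real_altdef by (simp only:) (simp add: field_simps)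
qed

lemma artanh_real_le_iff:
  fixes x y :: real
  assumes "\<bar>x\<bar> < 1" "\<bar>y\<bar> < 1"
  shows "artanh x \<le> artanh y \<longleftrightarrow> x \<le> y"
  by (metis assms tanh_artanh_real tanh_real_le_iff)

text \<open>At \<open>z = w\<close> the value is \<open>1 / (1 - (cmod w)\<^sup>2)\<close>, which is
  at least 1: the Moebius map expands at the point it sends to 0.\<close>

lemma has_field_derivative_disc_quot:
  assumes "cmod z < 1" "cmod w < 1"
  shows "((\<lambda>z. disc_quot z w) has_field_derivative
    of_real (1 - (cmod w)\<^sup>2) / (1 - cnj w * z)\<^sup>2) (at z)"
proof -
  have ww: "complex_of_real (1 - (cmod w)\<^sup>2) = 1 - w * cnj w"
    by (simp add: complex_mult_cnj cmod_power2)
  show ?thesis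
    unfolding disc_quot_def ww
    by (rule derivative_eq_intros refl disc_denom_nonzero[OF assms])+
      (simp add: power2_eq_square algebra_simps)
qed

section \<open>Differentials of holomorphic maps to the disc\<close>

lemma complex_manifold_atlasD:
  assumes "complex_manifold X" "c \<in> atlas X"
  shows "openin (mtop X) (fst c)" "open (snd c ` fst c)"
    "homeomorphic_map (subtopology (mtop X) (fst c)) (top_of_set (snd c ` fst c)) (snd c)"
  using assms by (auto simp: complex_manifold_def)

lemma coord_inv_coord:
  assumes "complex_manifold X" "c \<in> atlas X" "y \<in> fst c"
  shows "coord_inv c (snd c y) = y"
proof -
  have "inj_on (snd c) (fst c)"
    using complex_manifold_atlasD[OF assms(1,2)]
      homeomorphic_imp_injective_map openin_subset topspace_subtopology_subset by fastforce
  then show ?thesis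
    using assms(3) by (simp add: coord_inv_def)
qed

lemma open_coord_image:
  assumes X: "complex_manifold X" and c: "c \<in> atlas X" and Y: "openin (mtop X) Y"
  shows "open (snd c ` (fst c \<inter> Y))"
proof -
  note A = complex_manifold_atlasD[OF X c]
  have "openin (subtopology (mtop X) (fst c)) (fst c \<inter> Y)"
    using A(1) Y by (simp add: openin_open_subtopology openin_Int)
  then have "openin (top_of_set (snd c ` fst c)) (snd c ` (fst c \<inter> Y))"
    using homeomorphic_imp_open_map[OF A(3)] unfolding open_map_def by blast
  then show ?thesis
    using openin_open_eq[OF A(2)] by blast
qed

lemma charts_at_nonempty:
  assumes "complex_manifold X" "x \<in> topspace (mtop X)"
  shows "charts_at X x \<noteq> {}"
proof -
  have "x \<in> \<Union>(fst ` atlas X)"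
    using assms by (simp add: complex_manifold_def)
  then show ?thesis
    by (auto simp: charts_at_def)
qed

text \<open>The chart selected in \<open>differential\<close> depends on \<open>x\<close> alone, so
  one \<open>c\<close> serves all \<open>f\<close> and \<open>v\<close>, and \<open>v\<close> may be
  any family of coordinate vectors, tangent or not.\<close>

lemma differential_chart:
  assumes "complex_manifold X" "x \<in> topspace (mtop X)"
  obtains c where "c \<in> charts_at X x"
    "\<And>f v. differential X f x v = frechet_derivative (f \<circ> coord_inv c) (at (snd c x)) (v c)"
proof
  show "(SOME c. c \<in> charts_at X x) \<in> charts_at X x"
    using charts_at_nonempty[OF assms] some_in_eq by blast
  show "differential X f x v = frechet_derivative (f \<circ> coord_inv (SOME c. c \<in> charts_at X x))
      (at (snd (SOME c. c \<in> charts_at X x) x)) (v (SOME c. c \<in> charts_at X x))" for f v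
    by (simp add: differential_def Let_def)
qed

lemma holo_disc_mono: "U \<subseteq> Y \<Longrightarrow> f \<in> holo_disc X Y \<Longrightarrow> f \<in> holo_disc X U"
  unfolding holo_disc_def cholomorphic_on_def by blast

lemma holo_disc_norm: "f \<in> holo_disc X Y \<Longrightarrow> x \<in> Y \<Longrightarrow> cmod (f x) < 1"
  by (auto simp: holo_disc_def)

lemma holo_disc_has_derivative:
  assumes "f \<in> holo_disc X Y" "c \<in> charts_at X x" "x \<in> Y"
  obtains D where "((f \<circ> coord_inv c) has_derivative D) (at (snd c x))"
    "\<And>z v. D (scaleC z v) = z * D v"
proof -
  have "cholomorphic_on (f \<circ> coord_inv c) (snd c ` (fst c \<inter> Y))" "snd c x \<in> snd c ` (fst c \<inter> Y)"
    using assms by (auto simp: holo_disc_def charts_at_def)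
  then show ?thesis
    using that unfolding cholomorphic_on_def scaleC_complex_def by blast
qed

text \<open>By the chain rule in charts. The map \<open>h\<close> is differentiable on the whole
  disc but has to stay in the disc only on the values of \<open>f\<close>; this admits Moebius maps
  enlarged by a factor.\<close>

lemma holo_disc_compose:
  assumes X: "complex_manifold X" and f: "f \<in> holo_disc X Y"
    and h: "\<And>z. cmod z < 1 \<Longrightarrow> (h has_field_derivative h' z) (at z)"
    and less: "\<And>x. x \<in> Y \<Longrightarrow> cmod (h (f x)) < 1"
  shows "(\<lambda>x. h (f x)) \<in> holo_disc X Y"
  unfolding holo_disc_def cholomorphic_on_def scaleC_complex_def
proof (intro CollectI conjI ballI)
  fix c p assume c: "c \<in> atlas X" and "p \<in> snd c ` (fst c \<inter> Y)"
  then obtain x where x: "x \<in> fst c" "x \<in> Y" "p = snd c x"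
    by blast
  then have cx: "c \<in> charts_at X x"
    using c by (simp add: charts_at_def)
  obtain D where D: "((f \<circ> coord_inv c) has_derivative D) (at (snd c x))"
    "\<And>z v. D (scaleC z v) = z * D v"
    using holo_disc_has_derivative[OF f cx x(2)] by metis
  have "(h has_derivative (*) (h' (f x))) (at ((f \<circ> coord_inv c) (snd c x)))"
    using h[OF holo_disc_norm[OF f x(2)]] coord_inv_coord[OF X c x(1)]
    by (simp add: has_field_derivative_def)
  from diff_chain_at[OF D(1) this]
  have "((\<lambda>x. h (f x)) \<circ> coord_inv c has_derivative (\<lambda>v. h' (f x) * D v)) (at p)"
    by (simp add: o_def x(3))
  then show "\<exists>D. ((\<lambda>x. h (f x)) \<circ> coord_inv c has_derivative D) (at p) \<and>
      (\<forall>z v. D (scaleC z v) = z * D v)"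
    by (intro exI[of _ "\<lambda>v. h' (f x) * D v"]) (auto simp: D(2))
qed (use less in auto)

lemma differential_compose:
  assumes X: "complex_manifold X" and f: "f \<in> holo_disc X Y"
    and x: "x \<in> Y" "x \<in> topspace (mtop X)" and h: "(h has_field_derivative d) (at (f x))"
  shows "differential X (\<lambda>x. h (f x)) x v = d * differential X f x v"
proof -
  obtain c where c: "c \<in> charts_at X x"
    and diff: "\<And>f v. differential X f x v = frechet_derivative (f \<circ> coord_inv c) (at (snd c x)) (v c)"
    using differential_chart[OF X x(2)] by blast
  obtain D where D: "((f \<circ> coord_inv c) has_derivative D) (at (snd c x))"
    using holo_disc_has_derivative[OF f c x(1)] by metis
  have "(h has_derivative (*) d) (at ((f \<circ> coord_inv c) (snd c x)))"
    using h c coord_inv_coord[OF X, of c x] by (simp add: has_field_derivative_def charts_at_def)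
  from diff_chain_at[OF D this]
  have "((\<lambda>x. h (f x)) \<circ> coord_inv c has_derivative (\<lambda>v. d * D v)) (at (snd c x))"
    by (simp add: o_def)
  from frechet_derivative_at[OF this] frechet_derivative_at[OF D] show ?thesis
    unfolding diff by metis
qed

text \<open>In a chart \<open>f\<close> agrees with a constant near \<open>x\<close>. This serves
  the case \<open>k = 0\<close> of the comparison of the metrics.\<close>

lemma differential_locally_const:
  assumes X: "complex_manifold X" and Y: "openin (mtop X) Y" "x \<in> Y"
    and f: "\<And>y. y \<in> Y \<Longrightarrow> f y = f x"
  shows "differential X f x v = 0"
proof -
  have "x \<in> topspace (mtop X)"
    using Y openin_subset by blast
  then obtain c where c: "c \<in> charts_at X x"
    and diff: "\<And>f v. differential X f x v = frechet_derivative (f \<circ> coord_inv c) (at (snd c x)) (v c)"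
    using differential_chart[OF X] by blast
  then have cA: "c \<in> atlas X" "x \<in> fst c"
    by (auto simp: charts_at_def)
  have eq: "f x = (f \<circ> coord_inv c) p" if p: "p \<in> snd c ` (fst c \<inter> Y)" for p
  proof -
    obtain y where "y \<in> fst c" "y \<in> Y" "p = snd c y"
      using p by blast
    then show ?thesis
      using coord_inv_coord[OF X cA(1)] f[of y] by simp
  qed
  have "snd c x \<in> snd c ` (fst c \<inter> Y)"
    using cA Y by blast
  then have "((f \<circ> coord_inv c) has_derivative (\<lambda>_. 0)) (at (snd c x))"
    by (rule has_derivative_transform_within_open[OF has_derivative_const
          open_coord_image[OF X cA(1) Y(1)] _ eq])
  from frechet_derivative_at[OF this] show ?thesis
    unfolding diff by metis
qed

text \<open>If \<open>k > 0\<close>, the maps \<open>h \<circ> f\<close> with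
  \<open>h z = (r / k) * disc_quot z (f a)\<close> compete in the supremum for \<open>U\<close>. If
  \<open>k = 0\<close>, every \<open>f\<close> is constant on \<open>U\<close> and the left-hand
  side vanishes.\<close>

lemma cara_metric_le:
  assumes X: "complex_manifold X" and U: "openin (mtop X) U" "U \<subseteq> Y" "a \<in> U" and k: "0 \<le> k"
    and bound: "\<And>f x. f \<in> holo_disc X Y \<Longrightarrow> x \<in> U \<Longrightarrow> cmod (disc_quot (f x) (f a)) \<le> k"
  shows "cara_metric X Y a v \<le> ennreal k * cara_metric X U a v"
  unfolding cara_metric_def[of X Y]
proof (rule SUP_least)
  fix f assume f: "f \<in> holo_disc X Y"
  have fU: "f \<in> holo_disc X U"
    using holo_disc_mono[OF U(2) f] .
  have aX: "a \<in> topspace (mtop X)"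
    using U openin_subset by blast
  have norm: "cmod (f x) < 1" if "x \<in> U" for x
    using holo_disc_norm[OF fU that] .
  define q where "q = 1 - (cmod (f a))\<^sup>2"
  have q: "0 < q" "q \<le> 1"
    using norm[OF U(3)] by (auto simp: q_def abs_square_less_1)
  have qq: "1 - cnj (f a) * f a = of_real q"
    by (simp add: q_def complex_mult_cnj cmod_power2 mult.commute)
  define E where "E = cara_metric X U a v"
  define d where "d = cmod (differential X f a v)"
  have "ennreal d \<le> ennreal k * E"
  proof (cases "k = 0")
    case True
    have "f x = f a" if "x \<in> U" for x
      using bound[OF f that] disc_denom_nonzero[OF norm[OF that] norm[OF U(3)]] True
      by (simp add: disc_quot_def)
    then show ?thesis
      using differential_locally_const[OF X U(1,3), of f v] by (simp add: d_def)
  next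
    case False
    then have k: "k > 0"
      using \<open>0 \<le> k\<close> by simp
    \<comment> \<open>The factor \<open>r < 1\<close> is there because \<open>bound\<close> is a
      weak inequality while the disc is open.\<close>
    have le: "ennreal (r * d / k) \<le> E" if r: "0 < r" "r < 1" for r
    proof -
      define h where "h z = of_real (r / k) * disc_quot z (f a)" for z
      have h: "(h has_field_derivative
          of_real (r / k) * (of_real q / (1 - cnj (f a) * z)\<^sup>2)) (at z)" if "cmod z < 1" for z
        unfolding h_def q_def
        by (intro DERIV_cmult has_field_derivative_disc_quot that norm U(3))
      have less: "cmod (h (f x)) < 1" if "x \<in> U" for x
      proof -
        have "r * cmod (disc_quot (f x) (f a)) \<le> r * k"
          using r bound[OF f that] by (intro mult_left_mono) auto
        also have "\<dots> < k"
          using r k by simp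
        finally show ?thesis
          using r k by (simp add: h_def norm_mult norm_divide field_simps)
      qed
      have "(\<lambda>x. h (f x)) \<in> holo_disc X U"
        using holo_disc_compose[OF X fU h less] .
      then have "ennreal (cmod (differential X (\<lambda>x. h (f x)) a v)) \<le> E"
        unfolding E_def cara_metric_def by (rule SUP_upper)
      \<comment> \<open>At \<open>f a\<close> the Moebius map has derivative
        \<open>q / q\<^sup>2 = 1 / q\<close>; as \<open>q \<le> 1\<close>, dropping this factor only
        weakens the estimate.\<close>
      moreover have "cmod (differential X (\<lambda>x. h (f x)) a v) = r * d / k / q"
        unfolding differential_compose[OF X fU U(3) aX h[OF norm[OF U(3)]]] qq
        using r k q by (simp add: norm_mult norm_divide norm_power d_def power2_eq_square)
      moreover have "r * d / k \<le> r * d / k / q"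
      proof -
        have "0 \<le> r * d / k"
          using r k by (simp add: d_def)
        then show ?thesis
          using q mult_left_le[of q "r * d / k"] by (subst pos_le_divide_eq) auto
      qed
      ultimately show ?thesis
        by (metis ennreal_leI order_trans)
    qed
    show ?thesis
    proof (cases E)
      case (real e)
      have "d \<le> k * e"
      proof (rule field_le_mult_one_interval)
        fix r :: real assume r: "0 < r" "r < 1"
        show "r * d \<le> k * e"
          using le[OF r] k real by (simp add: field_simps)
      qed
      then show ?thesis
        using real k by (simp add: ennreal_leI flip: ennreal_mult)
    next
      case top
      then show ?thesis
        using k by (simp add: ennreal_mult_top)
    qed
  qed
  then show "ennreal (cmod (differential X f a v)) \<le> ennreal k * cara_metric X U a v"
    by (simp add: d_def E_def)
qed

section \<open>Finiteness of the Caratheodory diameter\<close>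

lemma bounded_linear_scaleC_left: "bounded_linear (\<lambda>z. scaleC z v)"
proof (rule bounded_linear_intro[where K = "norm v"])
  show "scaleC (r *\<^sub>R z) v = r *\<^sub>R scaleC z v" for r z
    by (simp add: scaleR_conv_of_real flip: scaleC_scaleC scaleC_of_real)
qed (simp_all add: scaleC_add_left norm_scaleC)

text \<open>Schwarz lemma on the complex lines through \<open>x\<close> in a chart.\<close>

lemma disc_quot_locally_bounded:
  assumes X: "complex_manifold X" and Y: "openin (mtop X) Y" "x \<in> Y"
  obtains V where "openin (mtop X) V" "x \<in> V" "V \<subseteq> Y"
    "\<And>f y. f \<in> holo_disc X Y \<Longrightarrow> y \<in> V \<Longrightarrow> cmod (disc_quot (f y) (f x)) \<le> 1/2"
proof -
  have "x \<in> topspace (mtop X)"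
    using Y openin_subset by blast
  then obtain c where c: "c \<in> charts_at X x"
    using charts_at_nonempty[OF X] by blast
  then have cA: "c \<in> atlas X" "x \<in> fst c"
    by (auto simp: charts_at_def)
  note A = complex_manifold_atlasD[OF X cA(1)]
  define p where "p = snd c x"
  have "open (snd c ` (fst c \<inter> Y))" "p \<in> snd c ` (fst c \<inter> Y)"
    using open_coord_image[OF X cA(1) Y(1)] Y cA by (auto simp: p_def)
  then obtain r where r: "r > 0" "ball p r \<subseteq> snd c ` (fst c \<inter> Y)"
    using open_contains_ball by metis
  \<comment> \<open>Half the radius leaves room for each point of \<open>V\<close> to sit at
    parameter \<open>1/2\<close> of a complex disc inside \<open>ball p r\<close>.\<close>
  define V where "V = {y \<in> fst c. snd c y \<in> ball p (r / 2)}"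
  have inY: "coord_inv c q \<in> Y \<and> q = snd c (coord_inv c q) \<and> coord_inv c q \<in> fst c"
    if "q \<in> ball p r" for q
    using r(2) that coord_inv_coord[OF X cA(1)] by auto
  show thesis
  proof
    have "continuous_map (subtopology (mtop X) (fst c)) (top_of_set (snd c ` fst c)) (snd c)"
      using A(3) homeomorphic_imp_continuous_map by blast
    then have "continuous_map (subtopology (mtop X) (fst c)) euclidean (snd c)"
      using continuous_map_into_fulltopology by blast
    then have "openin (subtopology (mtop X) (fst c))
        {y \<in> topspace (subtopology (mtop X) (fst c)). snd c y \<in> ball p (r / 2)}"
      by (rule openin_continuous_map_preimage) simp
    moreover have "topspace (subtopology (mtop X) (fst c)) = fst c"
      using openin_subset[OF A(1)] by auto
    ultimately show "openin (mtop X) V"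
      using openin_trans_full[OF _ A(1)] by (simp only: V_def)
    show "x \<in> V"
      using cA r by (simp add: V_def p_def)
    show "V \<subseteq> Y"
    proof
      fix y assume "y \<in> V"
      then show "y \<in> Y"
        using inY[of "snd c y"] coord_inv_coord[OF X cA(1)] r by (auto simp: V_def)
    qed
  next
    fix f y assume f: "f \<in> holo_disc X Y" and y: "y \<in> V"
    define h where "h = snd c y - p"
    have h: "norm h < r / 2"
      using y by (simp add: V_def h_def dist_norm norm_minus_commute)
    \<comment> \<open>The complex line through \<open>p\<close> and \<open>snd c y\<close>, scaled
      so that \<open>l 0 = p\<close> and \<open>l (1/2) = snd c y\<close>; the unit disc is mapped
      into \<open>ball p r\<close> because \<open>norm h < r / 2\<close>.\<close>
    define l where "l z = p + scaleC (2 * z) h" for z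
    have l: "l z \<in> ball p r" if "cmod z < 1" for z
    proof -
      have "norm (scaleC (2 * z) h) = cmod z * (2 * norm h)"
        by (simp add: norm_scaleC norm_mult)
      also have "\<dots> \<le> 1 * (2 * norm h)"
        using that by (intro mult_right_mono) auto
      also have "\<dots> < r"
        using h by simp
      finally show ?thesis
        by (simp add: l_def dist_norm)
    qed
    have x1: "cmod (f x) < 1"
      using holo_disc_norm[OF f Y(2)] .
    \<comment> \<open>Normalising by the Moebius map gives \<open>u 0 = 0\<close>, so the Schwarz
      lemma bounds \<open>u (1/2)\<close>, the quotient for \<open>y\<close> and \<open>x\<close>,
      by \<open>1/2\<close> for all \<open>f\<close> at once.\<close>
    define u where "u z = disc_quot (f (coord_inv c (l z))) (f x)" for z
    have "u holomorphic_on ball 0 1"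
      unfolding holomorphic_on_def field_differentiable_def
    proof (intro ballI)
      fix z :: complex assume "z \<in> ball 0 1"
      then have z: "l z \<in> ball p r"
        using l by simp
      note in' = inY[OF z]
      have cz: "c \<in> charts_at X (coord_inv c (l z))"
        using in' cA by (auto simp: charts_at_def)
      obtain D where D: "((f \<circ> coord_inv c) has_derivative D) (at (l z))"
        "\<And>z v. D (scaleC z v) = z * D v"
        using holo_disc_has_derivative[OF f cz] in' by metis
      have "(l has_derivative (\<lambda>w. scaleC (2 * w) h)) (at z)"
        unfolding l_def
        by (rule derivative_eq_intros refl
            bounded_linear.has_derivative[OF bounded_linear_scaleC_left])+ simp
      from diff_chain_at[OF this D(1)]
      have "(f \<circ> coord_inv c \<circ> l has_derivative (\<lambda>w. (2 * D h) * w)) (at z)"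
        by (simp add: o_def D(2) mult_ac)
      then have "((\<lambda>w. f (coord_inv c (l w))) has_field_derivative 2 * D h) (at z)"
        by (simp add: has_field_derivative_def o_def)
      moreover have "cmod (f (coord_inv c (l z))) < 1"
        using in' holo_disc_norm[OF f] by blast
      ultimately have "(u has_field_derivative (of_real (1 - (cmod (f x))\<^sup>2) /
          (1 - cnj (f x) * f (coord_inv c (l z)))\<^sup>2) * (2 * D h)) (at z)"
        unfolding u_def by (intro DERIV_chain2[OF has_field_derivative_disc_quot[OF _ x1]])
      then show "\<exists>d. (u has_field_derivative d) (at z within ball 0 1)"
        using has_field_derivative_at_within by blast
    qed
    moreover have "u 0 = 0"
      using coord_inv_coord[OF X cA] scaleC_of_real[of 0 h] by (simp add: u_def l_def p_def)
    moreover have "cmod (u z) < 1" if "cmod z < 1" for z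
      using inY[OF l[OF that]] holo_disc_norm[OF f] x1 by (simp add: u_def norm_disc_quot_less_1)
    ultimately have "cmod (u (1/2)) \<le> cmod (1/2)"
      by (rule Schwarz_Lemma(1)) auto
    moreover have "coord_inv c (l (1/2)) = y"
      using coord_inv_coord[OF X cA(1)] y scaleC_of_real[of 1 h]
      by (simp add: l_def h_def V_def)
    ultimately show "cmod (disc_quot (f y) (f x)) \<le> 1/2"
      by (simp add: u_def)
  qed
qed

text \<open>For points of \<open>Y\<close> and \<alpha> > 0 this is finiteness of
  \<open>cara_dist X Y x y\<close> with an explicit bound: 1 / cosh^2 of the Poincare distance stays
  above \<alpha> for all \<open>f\<close>. In this form constants combine by multiplication, without
  \<open>artanh\<close>.\<close>

definition cara_comparable :: "('a, 'e::complex_banach) cmanifold \<Rightarrow> 'a set \<Rightarrow> real \<Rightarrow> 'a \<Rightarrow> 'a \<Rightarrow> bool"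
  where "cara_comparable X Y \<alpha> x y \<longleftrightarrow>
    (\<forall>f\<in>holo_disc X Y. \<alpha> \<le> 1 - (cmod (disc_quot (f x) (f y)))\<^sup>2)"

lemma cara_comparable_sym: "cara_comparable X Y \<alpha> x y \<Longrightarrow> cara_comparable X Y \<alpha> y x"
  by (simp add: cara_comparable_def norm_disc_quot_commute)

lemma cara_comparable_trans:
  assumes "cara_comparable X Y \<alpha> x y" "cara_comparable X Y \<beta> y z"
    and "0 < \<alpha>" "0 < \<beta>" and Y: "x \<in> Y" "y \<in> Y" "z \<in> Y"
  shows "cara_comparable X Y (\<alpha> * \<beta> / 4) x z"
  unfolding cara_comparable_def
proof
  fix f assume f: "f \<in> holo_disc X Y"
  note n = holo_disc_norm[OF f]
  have "\<alpha> * \<beta> \<le> (1 - (cmod (disc_quot (f x) (f y)))\<^sup>2) * (1 - (cmod (disc_quot (f y) (f z)))\<^sup>2)"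
    using assms f by (intro mult_mono') (auto simp: cara_comparable_def)
  also have "\<dots> \<le> 4 * (1 - (cmod (disc_quot (f x) (f z)))\<^sup>2)"
    by (rule one_minus_norm_disc_quot_mult_le) (use n Y in auto)
  finally show "\<alpha> * \<beta> / 4 \<le> 1 - (cmod (disc_quot (f x) (f z)))\<^sup>2"
    by simp
qed

text \<open>A modulus of at most \<open>1/2\<close> gives \<open>1 - 1/4 = 3/4\<close>; the value
  \<open>1/2\<close> lies below that and suffices.\<close>

lemma cara_comparable_locally:
  assumes "complex_manifold X" "openin (mtop X) Y" "x \<in> Y"
  obtains V where "openin (mtop X) V" "x \<in> V" "V \<subseteq> Y"
    "\<And>y. y \<in> V \<Longrightarrow> cara_comparable X Y (1/2) x y"
proof -
  obtain V where V: "openin (mtop X) V" "x \<in> V" "V \<subseteq> Y"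
    and le: "\<And>f y. f \<in> holo_disc X Y \<Longrightarrow> y \<in> V \<Longrightarrow> cmod (disc_quot (f y) (f x)) \<le> 1/2"
    using disc_quot_locally_bounded[OF assms] by metis
  have "cara_comparable X Y (1/2) x y" if "y \<in> V" for y
  proof (rule cara_comparable_sym)
    have "(cmod (disc_quot (f y) (f x)))\<^sup>2 \<le> (1/2)\<^sup>2" if "f \<in> holo_disc X Y" for f
      using le[OF that \<open>y \<in> V\<close>] by (intro power_mono) auto
    then show "cara_comparable X Y (1/2) y x"
      by (fastforce simp: cara_comparable_def power2_eq_square)
  qed
  then show thesis
    using that V by blast
qed

text \<open>Connectedness puts \<open>U\<close> into the clopen set \<open>S\<close> of points at
  finite distance from \<open>x0\<close>, closedness puts the closure of \<open>U\<close> there, and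
  compactness replaces the constants at single points by a common one.\<close>

lemma cara_diameter_finite:
  assumes X: "complex_manifold X" and U: "domain_in (mtop X) U"
    and rc: "relatively_compact_in (mtop X) U"
  shows "cara_diameter X U < \<infinity>"
proof -
  let ?T = "topspace (mtop X)"
  note oT = openin_topspace[of "mtop X"]
  have Uo: "openin (mtop X) U" and Uc: "connectedin (mtop X) U" and "U \<noteq> {}"
    using U by (auto simp: domain_in_def)
  then obtain x0 where x0: "x0 \<in> U"
    by blast
  have UT: "U \<subseteq> ?T"
    using openin_subset[OF Uo] .
  define S where "S = {x \<in> ?T. \<exists>\<alpha>>0. cara_comparable X ?T \<alpha> x0 x}"
  \<comment> \<open>Open sets on which one constant works for all points. They cover
    \<open>S\<close> and are stable under finite unions, which is what the compactness argument
    needs.\<close>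
  define \<C> where "\<C> = {V. openin (mtop X) V \<and> (\<exists>\<alpha>>0. \<forall>y\<in>V. cara_comparable X ?T \<alpha> x0 y)}"
  have x0T: "x0 \<in> ?T"
    using x0 UT by blast
  have near: "\<exists>V\<in>\<C>. x \<in> V" if "x \<in> S" for x
  proof -
    from that obtain \<alpha> where \<alpha>: "\<alpha> > 0" "cara_comparable X ?T \<alpha> x0 x" and xT: "x \<in> ?T"
      by (auto simp: S_def)
    obtain V where V: "openin (mtop X) V" "x \<in> V" "V \<subseteq> ?T"
      "\<And>y. y \<in> V \<Longrightarrow> cara_comparable X ?T (1/2) x y"
      using cara_comparable_locally[OF X oT xT] by metis
    have "cara_comparable X ?T (\<alpha> * (1/2) / 4) x0 y" if "y \<in> V" for y
      by (rule cara_comparable_trans[OF \<alpha>(2) V(4)[OF that] \<alpha>(1) _ x0T xT]) (use that V(3) in auto)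
    moreover have "\<alpha> * (1/2) / 4 > 0"
      using \<alpha> by simp
    ultimately show ?thesis
      using V unfolding \<C>_def by blast
  qed
  have \<C>S: "V \<subseteq> S" if "V \<in> \<C>" for V
    using that openin_subset by (fastforce simp: \<C>_def S_def)
  have So: "openin (mtop X) S"
  proof (subst openin_subopen, intro ballI)
    fix x assume "x \<in> S"
    with near obtain V where V: "V \<in> \<C>" "x \<in> V"
      by blast
    then show "\<exists>T. openin (mtop X) T \<and> x \<in> T \<and> T \<subseteq> S"
      using \<C>S[OF V(1)] by (auto simp: \<C>_def)
  qed
  have Sc: "openin (mtop X) (?T - S)"
  proof (subst openin_subopen, intro ballI)
    fix x assume x: "x \<in> ?T - S"
    then obtain V where V: "openin (mtop X) V" "x \<in> V" "V \<subseteq> ?T"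
      "\<And>y. y \<in> V \<Longrightarrow> cara_comparable X ?T (1/2) x y"
      using cara_comparable_locally[OF X oT] by (metis DiffD1)
    \<comment> \<open>A point of \<open>S\<close> in \<open>V\<close> would be comparable to
      \<open>x\<close> and would pull \<open>x\<close> into \<open>S\<close>.\<close>
    have "y \<notin> S" if "y \<in> V" for y
    proof
      assume "y \<in> S"
      then obtain \<alpha> where \<alpha>: "\<alpha> > 0" "cara_comparable X ?T \<alpha> x0 y"
        by (auto simp: S_def)
      have "cara_comparable X ?T (\<alpha> * (1/2) / 4) x0 x"
        by (rule cara_comparable_trans[OF \<alpha>(2) cara_comparable_sym[OF V(4)[OF that]] \<alpha>(1) _ x0T])
          (use that x V(3) in auto)
      moreover have "\<alpha> * (1/2) / 4 > 0"
        using \<alpha> by simp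
      ultimately show False
        using x by (auto simp: S_def)
    qed
    then show "\<exists>T. openin (mtop X) T \<and> x \<in> T \<and> T \<subseteq> ?T - S"
      using V by blast
  qed
  have "x0 \<in> S"
  proof -
    have "cara_comparable X ?T 1 x0 x0"
      by (simp add: cara_comparable_def)
    then show ?thesis
      using x0T zero_less_one unfolding S_def by blast
  qed
  moreover have "U \<subseteq> S \<union> (?T - S)" "S \<inter> (?T - S) \<inter> U = {}"
    using UT by auto
  ultimately have "(?T - S) \<inter> U = {}"
    using Uc So Sc x0 unfolding connectedin by blast
  then have "U \<subseteq> S"
    using UT by blast
  moreover have "closedin (mtop X) S"
    using Sc by (auto simp: closedin_def S_def)
  ultimately have "mtop X closure_of U \<subseteq> S"
    by (simp add: closure_of_minimal)
  then have "mtop X closure_of U \<subseteq> \<Union>\<C>"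
    using near by blast
  moreover have "compactin (mtop X) (mtop X closure_of U)"
    using rc by (simp add: relatively_compact_in_def)
  ultimately obtain \<F> where \<F>: "finite \<F>" "\<F> \<subseteq> \<C>" "mtop X closure_of U \<subseteq> \<Union>\<F>"
    unfolding compactin_def \<C>_def by (metis (no_types, lifting) mem_Collect_eq)
  \<comment> \<open>The smaller of two constants serves for a union; for the empty union any
    positive constant does.\<close>
  have "\<Union>\<F> \<in> \<C>"
    using \<F>(1,2)
  proof (induction rule: finite_induct)
    case empty
    then show ?case
      by (auto simp: \<C>_def intro: zero_less_one)
  next
    case (insert V \<F>)
    then obtain \<alpha> \<beta> where "\<alpha> > 0" "\<forall>y\<in>V. cara_comparable X ?T \<alpha> x0 y"
      "\<beta> > 0" "\<forall>y\<in>\<Union>\<F>. cara_comparable X ?T \<beta> x0 y"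
      by (auto simp: \<C>_def)
    then have "\<forall>y\<in>\<Union>(insert V \<F>). cara_comparable X ?T (min \<alpha> \<beta>) x0 y" "min \<alpha> \<beta> > 0"
      by (auto simp: cara_comparable_def min_le_iff_disj)
    moreover have "openin (mtop X) (\<Union>(insert V \<F>))"
      using insert by (auto simp: \<C>_def)
    ultimately show ?case
      unfolding \<C>_def by blast
  qed
  moreover have "U \<subseteq> \<Union>\<F>"
    using \<F>(3) closure_of_subset[OF UT] by blast
  ultimately obtain \<alpha> where \<alpha>: "\<alpha> > 0" "\<And>y. y \<in> U \<Longrightarrow> cara_comparable X ?T \<alpha> x0 y"
    unfolding \<C>_def by blast
  \<comment> \<open>Going from \<open>x\<close> to \<open>y\<close> through \<open>x0\<close> costs
    \<alpha> * \<alpha> / 4. The \<open>max 0\<close> keeps the root nonnegative without an upper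
    bound on \<alpha>, and \<alpha> > 0 gives \<open>s < 1\<close>.\<close>
  define s where "s = sqrt (max 0 (1 - \<alpha> * \<alpha> / 4))"
  have s: "0 \<le> s" "s < 1"
    using \<alpha> by (auto simp: s_def)
  have "cara_dist X ?T x y \<le> ennreal (artanh s)" if "x \<in> U" "y \<in> U" for x y
    unfolding cara_dist_def
  proof (intro SUP_least ennreal_leI)
    fix f assume f: "f \<in> holo_disc X ?T"
    have n: "cmod (disc_quot (f x) (f y)) < 1"
      using holo_disc_norm[OF f] that UT by (simp add: norm_disc_quot_less_1 subset_iff)
    have "cara_comparable X ?T (\<alpha> * \<alpha> / 4) x y"
      by (rule cara_comparable_trans[OF cara_comparable_sym[OF \<alpha>(2)] \<alpha>(2) \<alpha>(1) \<alpha>(1)])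
        (use that UT x0T in auto)
    then have "(cmod (disc_quot (f x) (f y)))\<^sup>2 \<le> 1 - \<alpha> * \<alpha> / 4"
      using f by (fastforce simp: cara_comparable_def)
    then have "cmod (disc_quot (f x) (f y)) \<le> s"
      unfolding s_def by (intro real_le_rsqrt) auto
    then show "poincare_dist (f x) (f y) \<le> artanh s"
      using n s by (simp add: poincare_dist_disc_quot artanh_real_le_iff)
  qed
  then have "cara_diameter X U \<le> ennreal (artanh s)"
    unfolding cara_diameter_def by (intro SUP_least)
  then show ?thesis
    using ennreal_less_top le_less_trans infinity_ennreal_def by metis
qed

text \<open>This is where \<open>tanh M\<close> arises: \<open>tanh\<close> is monotone and turns
  the Poincare distance back into the modulus of the quotient. Finiteness matters because
  \<open>enn2real\<close> sends \<infinity> to 0.\<close>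

lemma norm_disc_quot_le_tanh_cara_diameter:
  assumes fin: "cara_diameter X U < \<infinity>" and U: "U \<subseteq> topspace (mtop X)" "x \<in> U" "y \<in> U"
    and f: "f \<in> holo_disc X (topspace (mtop X))"
  shows "cmod (disc_quot (f x) (f y)) \<le> tanh (enn2real (cara_diameter X U))"
proof -
  have n: "cmod (disc_quot (f x) (f y)) < 1"
    using holo_disc_norm[OF f] U by (simp add: norm_disc_quot_less_1 subset_iff)
  have "ennreal (poincare_dist (f x) (f y)) \<le> cara_dist X (topspace (mtop X)) x y"
    unfolding cara_dist_def using f by (rule SUP_upper)
  also have "\<dots> \<le> cara_diameter X U"
    unfolding cara_diameter_def using U by (blast intro: SUP_upper2)
  finally have "poincare_dist (f x) (f y) \<le> enn2real (cara_diameter X U)"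
    using fin by (cases "cara_diameter X U") auto
  then have "tanh (artanh (cmod (disc_quot (f x) (f y)))) \<le> tanh (enn2real (cara_diameter X U))"
    by (simp add: poincare_dist_disc_quot)
  then show ?thesis
    using n by (simp add: tanh_artanh_real)
qed

section \<open>Curves and lengths\<close>

text \<open>
  \<open>nn_integral_cmult\<close> needs a measurable function, and the Caratheodory metric along a path is not
  known to be measurable.
\<close>

lemma nn_integral_cmult_le:
  assumes "0 \<le> k"
  shows "(\<integral>\<^sup>+x. ennreal k * f x \<partial>M) \<le> ennreal k * (\<integral>\<^sup>+x. f x \<partial>M)"
proof (cases "k = 0")
  case False
  with assms have k: "k > 0"
    by simp
  then have inv: "ennreal k * ennreal (1 / k) = 1"
    by (simp flip: ennreal_mult)
  show ?thesis
    unfolding nn_integral_def[of M "\<lambda>x. ennreal k * f x"]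
  proof (rule SUP_least)
    fix g assume g: "g \<in> {g. simple_function M g \<and> g \<le> (\<lambda>x. ennreal k * f x)}"
    \<comment> \<open>Dividing a simple function below \<open>k * f\<close> by \<open>k\<close>
      gives one below \<open>f\<close>, and simple integrals are exactly homogeneous.\<close>
    define h where "h x = ennreal (1 / k) * g x" for x
    have gh: "g = (\<lambda>x. ennreal k * h x)"
      by (simp add: h_def inv flip: mult.assoc)
    have h: "simple_function M h"
      unfolding h_def using g by auto
    have "h x \<le> f x" for x
    proof -
      have "h x \<le> ennreal (1 / k) * (ennreal k * f x)"
        unfolding h_def using g by (intro mult_left_mono) (auto simp: le_fun_def)
      then show ?thesis
        by (metis inv mult.assoc mult.commute mult_1)
    qed
    then have "integral\<^sup>S M h \<le> (\<integral>\<^sup>+x. f x \<partial>M)"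
      unfolding nn_integral_def using h by (intro SUP_upper) (auto simp: le_fun_def)
    then show "integral\<^sup>S M g \<le> ennreal k * (\<integral>\<^sup>+x. f x \<partial>M)"
      unfolding gh simple_integral_mult[OF h] by (rule mult_left_mono) simp
  qed
qed simp

text \<open>The estimate is assumed for every \<open>v\<close> so that it also applies at
  breakpoints, where \<open>velocity\<close> need not be a tangent vector.\<close>

lemma cara_length_le:
  assumes "0 \<le> k" and "\<gamma> ` {0..1} \<subseteq> U"
    and "\<And>x v. x \<in> U \<Longrightarrow> cara_metric X Y x v \<le> ennreal k * cara_metric X U x v"
  shows "cara_length X Y \<gamma> \<le> ennreal k * cara_length X U \<gamma>"
proof -
  have "cara_length X Y \<gamma> \<le>
      (\<integral>\<^sup>+t. ennreal k * (cara_metric X U (\<gamma> t) (velocity X \<gamma> t) * indicator {0..1} t) \<partial>lborel)"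
    unfolding cara_length_def
    by (rule nn_integral_mono)
      (use assms(2) in \<open>auto split: split_indicator intro!: assms(3)\<close>)
  also have "\<dots> \<le> ennreal k * cara_length X U \<gamma>"
    unfolding cara_length_def by (rule nn_integral_cmult_le[OF assms(1)])
  finally show ?thesis .
qed

section \<open>Subarcs and affine reparametrization of curves\<close>

lemma affine_in_interval:
  fixes s t u :: real
  assumes "u \<in> {0..1}" "s \<le> t"
  shows "s + u * (t - s) \<in> {s..t}"
proof -
  have "0 \<le> u * (t - s)" "u * (t - s) \<le> 1 * (t - s)"
    by (rule mult_nonneg_nonneg mult_right_mono; use assms in simp)+
  then show ?thesis
    by simp
qed

lemma C1_curve_on_subinterval:
  assumes "C1_curve_on X s t \<gamma>" "{s'..t'} \<subseteq> {s..t}"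
  shows "C1_curve_on X s' t' \<gamma>"
  unfolding C1_curve_on_def
proof
  fix c assume "c \<in> atlas X"
  with assms(1) obtain D where D: "continuous_on {u \<in> {s..t}. \<gamma> u \<in> fst c} D"
    "\<And>u. u \<in> {s..t} \<Longrightarrow> \<gamma> u \<in> fst c \<Longrightarrow>
      ((snd c \<circ> \<gamma>) has_vector_derivative D u) (at u within {s..t})"
    unfolding C1_curve_on_def by blast
  have "continuous_on {u \<in> {s'..t'}. \<gamma> u \<in> fst c} D"
    by (rule continuous_on_subset[OF D(1)]) (use assms(2) in blast)
  moreover have "((snd c \<circ> \<gamma>) has_vector_derivative D u) (at u within {s'..t'})"
    if "u \<in> {s'..t'}" "\<gamma> u \<in> fst c" for u
    using has_vector_derivative_within_subset[OF D(2) assms(2)] that assms(2) by blast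
  ultimately show "\<exists>D. continuous_on {u \<in> {s'..t'}. \<gamma> u \<in> fst c} D \<and>
      (\<forall>u\<in>{s'..t'}. \<gamma> u \<in> fst c \<longrightarrow>
        ((snd c \<circ> \<gamma>) has_vector_derivative D u) (at u within {s'..t'}))"
    by blast
qed

lemma piecewise_C1_path_reparametrize:
  assumes C1: "C1_curve_on X s t \<gamma>" and cont: "continuous_map (top_of_set {s..t}) (mtop X) \<gamma>"
    and st: "s \<le> t"
  shows "piecewise_C1_path X (\<lambda>u. \<gamma> (s + u * (t - s)))"
proof -
  define l where "l u = s + u * (t - s)" for u
  have l: "l u \<in> {s..t}" if "u \<in> {0..1}" for u
    unfolding l_def using affine_in_interval[OF that st] .
  have lcont: "continuous_on A l" for A
    unfolding l_def by (intro continuous_intros)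
  have "continuous_map (top_of_set {0..1}) (mtop X) (\<gamma> \<circ> l)"
    by (rule continuous_map_compose[OF _ cont]) (use l lcont in auto)
  moreover have "C1_curve_on X 0 1 (\<gamma> \<circ> l)"
    unfolding C1_curve_on_def
  proof
    fix c assume "c \<in> atlas X"
    with C1 obtain D where D: "continuous_on {u \<in> {s..t}. \<gamma> u \<in> fst c} D"
      "\<And>u. u \<in> {s..t} \<Longrightarrow> \<gamma> u \<in> fst c \<Longrightarrow>
        ((snd c \<circ> \<gamma>) has_vector_derivative D u) (at u within {s..t})"
      unfolding C1_curve_on_def by blast
    have "continuous_on {u \<in> {0..1}. (\<gamma> \<circ> l) u \<in> fst c} (\<lambda>u. (t - s) *\<^sub>R D (l u))"
      by (intro continuous_intros continuous_on_compose2[OF D(1) lcont]) (use l in auto)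
    moreover have "((snd c \<circ> (\<gamma> \<circ> l)) has_vector_derivative (t - s) *\<^sub>R D (l u))
        (at u within {0..1})" if u: "u \<in> {0..1}" "(\<gamma> \<circ> l) u \<in> fst c" for u
    proof -
      have "(l has_vector_derivative (t - s)) (at u within {0..1})"
        unfolding l_def by (auto intro!: derivative_eq_intros)
      moreover have "l ` {0..1} \<subseteq> {s..t}"
        using l by blast
      then have "((snd c \<circ> \<gamma>) has_vector_derivative D (l u)) (at (l u) within l ` {0..1})"
        using has_vector_derivative_within_subset[OF D(2)[OF l[OF u(1)]]] u(2) by simp
      ultimately have "((snd c \<circ> \<gamma> \<circ> l) has_vector_derivative (t - s) *\<^sub>R D (l u))
          (at u within {0..1})"
        by (rule vector_diff_chain_within)
      then show ?thesis
        by (simp add: o_assoc)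
    qed
    ultimately show "\<exists>D. continuous_on {u \<in> {0..1}. (\<gamma> \<circ> l) u \<in> fst c} D \<and>
        (\<forall>u\<in>{0..1}. (\<gamma> \<circ> l) u \<in> fst c \<longrightarrow>
          ((snd c \<circ> (\<gamma> \<circ> l)) has_vector_derivative D u) (at u within {0..1}))"
      by blast
  qed
  \<comment> \<open>The partition is the embedding \<open>real\<close> with \<open>m = 1\<close>, a
    single piece from 0 to 1. It also covers \<open>s = t\<close>, where the new path is
    constant.\<close>
  then have "\<exists>(p :: nat \<Rightarrow> real) m. p 0 = 0 \<and> p m = 1 \<and>
      (\<forall>i<m. p i < p (Suc i) \<and> C1_curve_on X (p i) (p (Suc i)) (\<gamma> \<circ> l))"
    by (intro exI[of _ real] exI[of _ 1]) simp
  ultimately show ?thesis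
    by (simp add: piecewise_C1_path_def o_def l_def)
qed

text \<open>
  The case \<open>k = 0\<close> of the theorem. It needs its own argument, as \<open>0 * \<infinity> = 0\<close> in \<open>ennreal\<close> and \<open>U\<close> is not
  yet known to be connected by \<open>C\<^sup>1\<close> paths: hyperbolicity forces every path that starts in \<open>U\<close> to
  stay at its starting point, and there is a path in \<open>X\<close> between any two points.
\<close>

locale degenerate_subset =
  fixes X :: "('a, 'e::complex_banach) cmanifold" and U :: "'a set"
  assumes manifold: "complex_manifold X"
    and hyperbolic: "cara_inner_hyperbolic X"
    and openin_U: "openin (mtop X) U"
    and metric_zero: "\<And>x v. x \<in> U \<Longrightarrow> cara_metric X (topspace (mtop X)) x v = 0"
begin

text \<open>The metric axiom concerns \<open>enn2real\<close>, which vanishes at \<infinity> too;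
  finiteness excludes that value.\<close>

lemma inner_dist_eq_0_iff:
  assumes "x \<in> topspace (mtop X)" "y \<in> topspace (mtop X)"
  shows "cara_inner_dist X (topspace (mtop X)) x y = 0 \<longleftrightarrow> x = y"
proof -
  interpret Metric_space "topspace (mtop X)"
    "\<lambda>a b. enn2real (cara_inner_dist X (topspace (mtop X)) a b)"
    using hyperbolic by (simp add: cara_inner_hyperbolic_def)
  have "cara_inner_dist X (topspace (mtop X)) x y < \<infinity>"
    using hyperbolic assms by (simp add: cara_inner_hyperbolic_def)
  then show ?thesis
    using zero[OF assms] by (auto simp: enn2real_eq_0_iff)
qed

text \<open>Inside \<open>U\<close> the metric vanishes, so the reparametrized curve has length 0
  and hyperbolicity identifies its endpoints.\<close>

lemma C1_curve_endpoints_eq: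
  assumes C1: "C1_curve_on X s t \<gamma>" and cont: "continuous_map (top_of_set {s..t}) (mtop X) \<gamma>"
    and st: "s \<le> t" and U: "\<gamma> ` {s..t} \<subseteq> U"
  shows "\<gamma> s = \<gamma> t"
proof -
  let ?T = "topspace (mtop X)"
  define \<delta> where "\<delta> u = \<gamma> (s + u * (t - s))" for u
  have UT: "U \<subseteq> ?T"
    using openin_subset[OF openin_U] .
  have \<delta>U: "\<delta> u \<in> U" if "u \<in> {0..1}" for u
    unfolding \<delta>_def using U affine_in_interval[OF that st] by blast
  have "piecewise_C1_path X \<delta>"
    unfolding \<delta>_def by (rule piecewise_C1_path_reparametrize[OF C1 cont st])
  then have "cara_inner_dist X ?T (\<gamma> s) (\<gamma> t) \<le> cara_length X ?T \<delta>"
    unfolding cara_inner_dist_def using \<delta>U UT by (intro INF_lower) (auto simp: \<delta>_def)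
  also have "cara_length X ?T \<delta> = (\<integral>\<^sup>+(t::real). 0 \<partial>lborel)"
    unfolding cara_length_def
    by (rule nn_integral_cong) (use \<delta>U metric_zero in \<open>auto split: split_indicator\<close>)
  finally have "cara_inner_dist X ?T (\<gamma> s) (\<gamma> t) = 0"
    by simp
  moreover have "\<gamma> s \<in> ?T" "\<gamma> t \<in> ?T"
    using \<delta>U[of 0] \<delta>U[of 1] UT by (auto simp: \<delta>_def)
  ultimately show ?thesis
    using inner_dist_eq_0_iff by blast
qed

text \<open>The set \<open>A\<close> of times spent at the starting point is closed by the Hausdorff
  property. It is open because around such a time the curve stays in \<open>U\<close>, where the
  endpoints of every subarc agree. Only the starting point is assumed to lie in
  \<open>U\<close>.\<close>

lemma C1_curve_constant:
  assumes C1: "C1_curve_on X l r \<gamma>" and cont: "continuous_map (top_of_set {l..r}) (mtop X) \<gamma>"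
    and lr: "l \<le> r" and l: "\<gamma> l \<in> U"
  shows "\<gamma> r = \<gamma> l"
proof -
  define A where "A = {u \<in> {l..r}. \<gamma> u = \<gamma> l}"
  have T: "\<gamma> u \<in> topspace (mtop X)" if "u \<in> {l..r}" for u
    using continuous_map_image_subset_topspace[OF cont] that by auto
  have "closedin (mtop X) {\<gamma> l}"
    using manifold T lr by (simp add: complex_manifold_def closedin_Hausdorff_singleton)
  from closedin_continuous_map_preimage[OF cont this]
  have closed: "closedin (top_of_set {l..r}) A"
    by (simp add: A_def)
  have W: "openin (top_of_set {l..r}) {u \<in> {l..r}. \<gamma> u \<in> U}"
    using openin_continuous_map_preimage[OF cont openin_U] by simp
  have "openin (top_of_set {l..r}) A"
    unfolding openin_contains_ball
  proof (intro conjI ballI)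
    fix u assume u: "u \<in> A"
    then have "u \<in> {u \<in> {l..r}. \<gamma> u \<in> U}"
      using l by (auto simp: A_def)
    with W obtain e where e: "e > 0" "ball u e \<inter> {l..r} \<subseteq> {u \<in> {l..r}. \<gamma> u \<in> U}"
      unfolding openin_contains_ball by blast
    have eq: "\<gamma> v = \<gamma> w" if "v \<in> ball u e \<inter> {l..r}" "w \<in> ball u e \<inter> {l..r}" "v \<le> w" for v w
    proof (rule C1_curve_endpoints_eq[OF _ _ that(3)])
      have sub: "{v..w} \<subseteq> {l..r}" and "{v..w} \<subseteq> ball u e"
        using that by (auto simp: dist_real_def)
      then show "\<gamma> ` {v..w} \<subseteq> U"
        using e by blast
      show "C1_curve_on X v w \<gamma>"
        using C1_curve_on_subinterval[OF C1 sub] .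
      show "continuous_map (top_of_set {v..w}) (mtop X) \<gamma>"
        using continuous_map_from_subtopology_mono[OF cont sub] .
    qed
    have "w \<in> A" if w: "w \<in> ball u e \<inter> {l..r}" for w
    proof -
      have "u \<in> ball u e \<inter> {l..r}"
        using u e by (auto simp: A_def)
      then have "\<gamma> w = \<gamma> u"
        using eq w by (metis linear)
      then show ?thesis
        using u w by (auto simp: A_def)
    qed
    then show "\<exists>e>0. ball u e \<inter> {l..r} \<subseteq> A"
      using e by blast
  qed (auto simp: A_def)
  moreover have "connected {l..r}"
    by simp
  ultimately have "A = {} \<or> A = {l..r}"
    using closed unfolding connected_clopen by blast
  moreover have "l \<in> A"
    using lr by (simp add: A_def)
  moreover have "r \<in> {l..r}"
    using lr by simp
  ultimately have "r \<in> A"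
    by blast
  then show ?thesis
    by (simp add: A_def)
qed

text \<open>A finite distance supplies a path from \<open>a\<close> to \<open>b\<close>. Piece by
  piece its breakpoints remain at \<open>a\<close>, so \<open>b = a\<close>.\<close>

lemma inner_dist_eq_0:
  assumes a: "a \<in> U" and b: "b \<in> topspace (mtop X)"
  shows "cara_inner_dist X (topspace (mtop X)) a b = 0"
proof -
  let ?T = "topspace (mtop X)"
  have aT: "a \<in> ?T"
    using a openin_subset[OF openin_U] by blast
  have "cara_inner_dist X ?T a b < \<infinity>"
    using hyperbolic aT b by (simp add: cara_inner_hyperbolic_def)
  \<comment> \<open>An empty set of paths would make the infimum infinite.\<close>
  then have "{\<gamma>. piecewise_C1_path X \<gamma> \<and> \<gamma> ` {0..1} \<subseteq> ?T \<and> \<gamma> 0 = a \<and> \<gamma> 1 = b} \<noteq> {}"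
    unfolding cara_inner_dist_def
    by (metis (no_types, lifting) INF_empty infinity_ennreal_def less_irrefl)
  then obtain \<gamma> where \<gamma>: "piecewise_C1_path X \<gamma>" "\<gamma> 0 = a" "\<gamma> 1 = b"
    by blast
  then obtain p :: "nat \<Rightarrow> real" and m where p: "p 0 = 0" "p m = 1"
    "\<And>i. i < m \<Longrightarrow> p i < p (Suc i)"
    "\<And>i. i < m \<Longrightarrow> C1_curve_on X (p i) (p (Suc i)) \<gamma>"
    and cont: "continuous_map (top_of_set {0..1}) (mtop X) \<gamma>"
    unfolding piecewise_C1_path_def by blast
  have mono: "p i \<le> p j" if "i \<le> j" "j \<le> m" for i j
    using that
  proof (induction j rule: dec_induct)
    case (step j)
    then show ?case
      using p(3)[of j] by simp
  qed simp
  have "\<gamma> (p i) = a" if "i \<le> m" for i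
    using that
  proof (induction i)
    case 0
    then show ?case
      using p \<gamma> by simp
  next
    case (Suc i)
    have "{p i..p (Suc i)} \<subseteq> {0..1}"
      using mono[of 0 i] mono[of "Suc i" m] Suc.prems p by simp
    then have "continuous_map (top_of_set {p i..p (Suc i)}) (mtop X) \<gamma>"
      by (rule continuous_map_from_subtopology_mono[OF cont])
    then have "\<gamma> (p (Suc i)) = \<gamma> (p i)"
      using C1_curve_constant[OF p(4)[of i]] Suc a mono[of i "Suc i"] by simp
    then show ?case
      using Suc by simp
  qed
  from this[of m] have "a = b"
    using p \<gamma> by simp
  then show ?thesis
    using inner_dist_eq_0_iff aT by blast
qed

end

theorem theorem1:
  fixes X :: "('a, 'e::complex_banach) cmanifold" and U :: "'a set"
  assumes "complex_manifold X"
    and "cara_inner_hyperbolic X"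
    and "domain_in (mtop X) U"
    and "relatively_compact_in (mtop X) U"
  shows "cara_diameter X U < \<infinity> \<and>
    (\<exists>k::real. k = tanh (enn2real (cara_diameter X U)) \<and> k < 1 \<and>
      (\<forall>a\<in>U. \<forall>v\<in>tangent_space X a.
        cara_metric X (topspace (mtop X)) a v \<le> ennreal k * cara_metric X U a v) \<and>
      (\<forall>a\<in>U. \<forall>b\<in>U.
        cara_inner_dist X (topspace (mtop X)) a b \<le> ennreal k * cara_inner_dist X U a b))"
proof -
  let ?T = "topspace (mtop X)"
  define k where "k = tanh (enn2real (cara_diameter X U))"
  have fin: "cara_diameter X U < \<infinity>"
    using cara_diameter_finite assms(1,3,4) .
  have k: "0 \<le> k" "k < 1"
    by (simp_all add: k_def tanh_real_lt_1)
  have U: "openin (mtop X) U" and UT: "U \<subseteq> ?T"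
    using assms(3) openin_subset by (auto simp: domain_in_def)
  have metric: "cara_metric X ?T a v \<le> ennreal k * cara_metric X U a v" if "a \<in> U" for a v
    unfolding k_def
    by (rule cara_metric_le[OF assms(1) U UT that])
      (use norm_disc_quot_le_tanh_cara_diameter[OF fin UT _ that] in auto)
  have inner: "cara_inner_dist X ?T a b \<le> ennreal k * cara_inner_dist X U a b"
    if ab: "a \<in> U" "b \<in> U" for a b
  proof (cases "k = 0")
    case True
    \<comment> \<open>For \<open>k = 0\<close> the right-hand side of \<open>metric\<close> is 0
      whatever the metric of \<open>U\<close> is, so the metric of \<open>X\<close> vanishes on
      \<open>U\<close>.\<close>
    then interpret degenerate_subset X U
      using assms(1,2) U metric by unfold_locales auto
    show ?thesis
      using inner_dist_eq_0[OF ab(1), of b] ab(2) UT by auto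
  next
    case False
    then have k0: "ennreal k \<noteq> 0" "0 < ennreal k"
      using k by auto
    \<comment> \<open>Dividing by \<open>k\<close> isolates the infimum, so that each path in
      \<open>U\<close> can be treated separately; it is also a path in \<open>X\<close>.\<close>
    have "cara_inner_dist X ?T a b / ennreal k \<le> cara_inner_dist X U a b"
      unfolding cara_inner_dist_def[of X U]
    proof (rule INF_greatest)
      fix \<gamma> assume "\<gamma> \<in> {\<gamma>. piecewise_C1_path X \<gamma> \<and> \<gamma> ` {0..1} \<subseteq> U \<and> \<gamma> 0 = a \<and> \<gamma> 1 = b}"
      then have \<gamma>: "piecewise_C1_path X \<gamma>" "\<gamma> ` {0..1} \<subseteq> U" "\<gamma> 0 = a" "\<gamma> 1 = b"
        by auto
      then have "cara_inner_dist X ?T a b \<le> cara_length X ?T \<gamma>"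
        unfolding cara_inner_dist_def using UT by (intro INF_lower) blast
      also have "\<dots> \<le> ennreal k * cara_length X U \<gamma>"
        by (rule cara_length_le[OF k(1) \<gamma>(2) metric])
      finally show "cara_inner_dist X ?T a b / ennreal k \<le> cara_length X U \<gamma>"
        by (rule divide_le_posI_ennreal[OF k0(2)])
    qed
    then have "ennreal k * (cara_inner_dist X ?T a b / ennreal k) \<le>
        ennreal k * cara_inner_dist X U a b"
      by (rule mult_left_mono) simp
    moreover have "ennreal k * (cara_inner_dist X ?T a b / ennreal k) = cara_inner_dist X ?T a b"
      using k0 by (simp add: ennreal_times_divide mult.commute[of "ennreal k"] mult_divide_eq_ennreal)
    ultimately show ?thesis
      by simp
  qed
  show ?thesis
    using fin k metric inner unfolding k_def by blast
qed

end
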